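(* Let $d_{i,j}>0$ ($i\in[N]$, $j\in[m_i]$) and $a_{i,j}>0$ ($i,j\in[N]$) be degrees. If each $g_{i,j}$ is a generic polynomial in $x_i$ of degree $d_{i,j}$, and each $f_i$ is a generic polynomial in $x=(x_1,\ldots,x_N)$ whose degree in $x_j$ is $a_{i,j}$, then the KKT system $$\sum_{j=1}^{m_i}\lambda_{i,j}\nabla_{x_i}g_{i,j}(x_i)=\nabla_{x_i}f_i(x)\quad(i\in[N]),\qquad g_{i,j}(x_i)=0\quad(i\in[N],\ j\in[m_i])$$ in the unknowns $x\in\mathbb{C}^n$ and $\lambda_{i,j}\in\mathbb{C}$ has finitely many complex solutions, and hence the Nash equilibrium problem with objectives $f_i$ and constraining polynomials $g_{i,j}$ has finitely many KKT points.
   Context: **Setting.** There are $N$ players; player $i$ has strategy $x_i\in\mathbb{R}^{n_i}$; $x=(x_1,\ldots,x_N)\in\mathbb{R}^n$, $n=n_1+\cdots+n_N$; $[N]=\{1,\ldots,N\}$. Player $i$ has an objective $f_i\in\mathbb{R}[x]$ and constraining polynomials $g_{i,j}\in\mathbb{R}[x_i]$, $j\in[m_i]=\mathcal{E}_i\sqcup\mathcal{I}_i$; for fixed strategies $x_{-i}$ of the others, player $i$ minimizes $f_i(x_i,x_{-i})$ over $x_i$ subject to $g_{i,j}(x_i)=0$ $(j\in\mathcal{E}_i)$ and $g_{i,j}(x_i)\ge0$ $(j\in\mathcal{I}_i)$. **KKT points.** A point $x\in\mathbb{R}^n$, feasible for all players, is a KKT point of the Nash equilibrium problem if there exist real multipliers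 $\lambda_{i,j}$ such that for every $i$: $\sum_{j=1}^{m_i}\lambda_{i,j}\nabla_{x_i}g_{i,j}(x_i)=\nabla_{x_i}f_i(x)$, and $\lambda_{i,j}\ge0$, $g_{i,j}(x_i)\ge0$, $\lambda_{i,j}g_{i,j}(x_i)=0$ for $j\in\mathcal{I}_i$. The KKT system in the claim is written for the case of equality constraints only and without the sign conditions on multipliers: for a problem with inequality constraints one enumerates all possibilities of active constraints (finitely many choices of subsets of $[m_i]$ for each $i$) and considers the system for the active constraints, which accordingly may be taken to number at most $n_i$ for player $i$. **Genericity.** A property holds for generic polynomials of the given (multi-)degrees if it holds for all coefficient vectors outside a set of Lebesgue measure zero in the space of coefficients. Here $g_{i,j}$ ranges over polynomials in $x_i$ of degree at most $d_{i,j}$ and $f_i$ over polynomials in $x$ of degree at most $a_{i,j}$ in the block $x_j$ for each $j\in[N]$. *)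

theory Defs
  imports "HOL-Analysis.Analysis" "HOL-Library.Poly_Mapping"
begin

section \<open>Multivariate polynomials with real coefficients\<close>

text \<open>A monomial is its finitely supported exponent vector, and a polynomial is a finitely
  supported coefficient function on monomials.\<close>

type_synonym 'v monom = "'v \<Rightarrow>\<^sub>0 nat"
type_synonym 'v rpoly = "'v monom \<Rightarrow>\<^sub>0 real"

definition monom_eval :: "'v monom \<Rightarrow> ('v \<Rightarrow> 'a) \<Rightarrow> 'a::real_normed_field" where
  "monom_eval \<alpha> x = (\<Prod>v\<in>Poly_Mapping.keys \<alpha>. x v ^ Poly_Mapping.lookup \<alpha> v)"

text \<open>Evaluation at points with real or complex coordinates.\<close>

definition poly_eval :: "'v rpoly \<Rightarrow> ('v \<Rightarrow> 'a) \<Rightarrow> 'a::real_normed_field" where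
  "poly_eval p x =
     (\<Sum>\<alpha>\<in>Poly_Mapping.keys p. of_real (Poly_Mapping.lookup p \<alpha>) * monom_eval \<alpha> x)"

text \<open>Formal partial derivative. If the variable \<open>v\<close> does not occur in \<open>\<alpha>\<close>, the subtraction
  of exponents truncates, but the coefficient is then 0.\<close>

definition pdiff :: "'v \<Rightarrow> 'v rpoly \<Rightarrow> 'v rpoly" where
  "pdiff v p = (\<Sum>\<alpha>\<in>Poly_Mapping.keys p.
     Poly_Mapping.single (\<alpha> - Poly_Mapping.single v 1)
       (Poly_Mapping.lookup p \<alpha> * real (Poly_Mapping.lookup \<alpha> v)))"

definition poly_of_coeffs :: "'v monom set \<Rightarrow> ('v monom \<Rightarrow> real) \<Rightarrow> 'v rpoly" where
  "poly_of_coeffs A c = (\<Sum>\<alpha>\<in>A. Poly_Mapping.single \<alpha> (c \<alpha>))"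

definition degree_in :: "'v set \<Rightarrow> 'v monom \<Rightarrow> nat" where
  "degree_in S \<alpha> = (\<Sum>v\<in>S. Poly_Mapping.lookup \<alpha> v)"


lemma monom_eval_superset:
  assumes "finite S" "Poly_Mapping.keys \<alpha> \<subseteq> S"
  shows "monom_eval \<alpha> x = (\<Prod>v\<in>S. x v ^ Poly_Mapping.lookup \<alpha> v)"
  unfolding monom_eval_def
  by (rule prod.mono_neutral_left) (use assms in \<open>auto simp: in_keys_iff\<close>)

lemma poly_eval_superset:
  assumes "finite S" "Poly_Mapping.keys p \<subseteq> S"
  shows "poly_eval p x = (\<Sum>\<alpha>\<in>S. of_real (Poly_Mapping.lookup p \<alpha>) * monom_eval \<alpha> x)"
  unfolding poly_eval_def
  by (rule sum.mono_neutral_left) (use assms in \<open>auto simp: in_keys_iff\<close>)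

lemma poly_eval_0 [simp]: "poly_eval 0 x = 0"
  by (simp add: poly_eval_def)

lemma poly_eval_add: "poly_eval (p + q) x = poly_eval p x + poly_eval q x"
proof -
  let ?S = "Poly_Mapping.keys p \<union> Poly_Mapping.keys q"
  have "poly_eval (p + q) x
      = (\<Sum>\<alpha>\<in>?S. of_real (Poly_Mapping.lookup (p + q) \<alpha>) * monom_eval \<alpha> x)"
    by (rule poly_eval_superset) (auto dest: subsetD[OF Poly_Mapping.keys_add])
  also have "\<dots> = poly_eval p x + poly_eval q x"
    by (simp add: poly_eval_superset[of ?S] lookup_add distrib_right sum.distrib)
  finally show ?thesis .
qed

lemma poly_eval_sum: "poly_eval (\<Sum>a\<in>A. p a) x = (\<Sum>a\<in>A. poly_eval (p a) x)"
  by (induction A rule: infinite_finite_induct) (auto simp: poly_eval_add)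

lemma poly_eval_single:
  "poly_eval (Poly_Mapping.single \<alpha> c) x = of_real c * monom_eval \<alpha> x"
  by (simp add: poly_eval_superset[of "{\<alpha>}"])

lemma monom_eval_has_field_derivative:
  fixes x :: "'v \<Rightarrow> 'a::real_normed_field"
  shows "((\<lambda>t. monom_eval \<alpha> (x(v := t))) has_field_derivative
     of_nat (Poly_Mapping.lookup \<alpha> v) * monom_eval (\<alpha> - Poly_Mapping.single v 1) x) (at (x v))"
proof -
  let ?S = "insert v (Poly_Mapping.keys \<alpha>)" and ?T = "Poly_Mapping.keys \<alpha> - {v}"
  let ?C = "\<Prod>w\<in>?T. x w ^ Poly_Mapping.lookup \<alpha> w"
  have S: "?S = insert v ?T"
    by auto
  have 1: "monom_eval \<alpha> (x(v := t)) = t ^ Poly_Mapping.lookup \<alpha> v * ?C" for t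
  proof -
    have "monom_eval \<alpha> (x(v := t)) = (\<Prod>w\<in>?S. (x(v := t)) w ^ Poly_Mapping.lookup \<alpha> w)"
      by (rule monom_eval_superset) auto
    also have "\<dots> = t ^ Poly_Mapping.lookup \<alpha> v *
        (\<Prod>w\<in>?T. (x(v := t)) w ^ Poly_Mapping.lookup \<alpha> w)"
      unfolding S by (subst prod.insert) auto
    also have "(\<Prod>w\<in>?T. (x(v := t)) w ^ Poly_Mapping.lookup \<alpha> w) = ?C"
      by (rule prod.cong) auto
    finally show ?thesis .
  qed
  have 2: "monom_eval (\<alpha> - Poly_Mapping.single v 1) x
      = x v ^ (Poly_Mapping.lookup \<alpha> v - 1) * ?C"
  proof -
    have "monom_eval (\<alpha> - Poly_Mapping.single v 1) x
        = (\<Prod>w\<in>?S. x w ^ Poly_Mapping.lookup (\<alpha> - Poly_Mapping.single v 1) w)"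
      by (rule monom_eval_superset) (auto simp: in_keys_iff lookup_minus)
    also have "\<dots> = x v ^ (Poly_Mapping.lookup \<alpha> v - 1) *
        (\<Prod>w\<in>?T. x w ^ Poly_Mapping.lookup (\<alpha> - Poly_Mapping.single v 1) w)"
      unfolding S by (subst prod.insert) (auto simp: lookup_minus)
    also have "(\<Prod>w\<in>?T. x w ^ Poly_Mapping.lookup (\<alpha> - Poly_Mapping.single v 1) w) = ?C"
      by (rule prod.cong) (auto simp: lookup_minus lookup_single)
    finally show ?thesis .
  qed
  show ?thesis
    unfolding 1 2 by (auto intro!: derivative_eq_intros)
qed

lemma poly_eval_has_field_derivative:
  fixes x :: "'v \<Rightarrow> 'a::real_normed_field"
  shows "((\<lambda>t. poly_eval p (x(v := t))) has_field_derivative poly_eval (pdiff v p) x) (at (x v))"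
proof -
  have "((\<lambda>t. poly_eval p (x(v := t))) has_field_derivative
      (\<Sum>\<alpha>\<in>Poly_Mapping.keys p. of_real (Poly_Mapping.lookup p \<alpha>) *
         (of_nat (Poly_Mapping.lookup \<alpha> v) * monom_eval (\<alpha> - Poly_Mapping.single v 1) x))) (at (x v))"
    unfolding poly_eval_def
    by (intro DERIV_sum DERIV_cmult monom_eval_has_field_derivative)
  then show ?thesis
    by (simp add: pdiff_def poly_eval_sum poly_eval_single mult.assoc)
qed

lemma finite_monoms:
  assumes "finite V"
  shows "finite {\<alpha> :: 'v monom. Poly_Mapping.keys \<alpha> \<subseteq> V \<and>
           (\<forall>v\<in>V. Poly_Mapping.lookup \<alpha> v \<le> D)}" (is "finite ?A")
proof -
  have "Poly_Mapping.lookup ` ?A \<subseteq> {h. \<forall>v. (v \<in> V \<longrightarrow> h v \<in> {..D}) \<and> (v \<notin> V \<longrightarrow> h v = 0)}"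
    by (auto simp: in_keys_iff)
  then have "finite (Poly_Mapping.lookup ` ?A)"
    by (rule finite_subset) (intro finite_set_of_finite_funs assms finite_atMost)
  then show ?thesis
    by (rule finite_imageD) (auto intro: inj_onI poly_mapping_eqI)
qed


section \<open>Nash equilibrium problems of polynomials\<close>

text \<open>Players are \<open>{..<N}\<close>, and the constraints of player \<open>i\<close> are \<open>{..<m i}\<close>. The coordinate \<open>k < n i\<close>
  of the strategy of player \<open>i\<close> is the variable \<open>(i, k)\<close>, so a joint strategy is a function on
  \<open>vars N n\<close>. Since the number of coordinates depends on the player, points are extensional
  functions, so that finiteness of a set of points is meaningful.\<close>

type_synonym var = "nat \<times> nat"

definition block :: "(nat \<Rightarrow> nat) \<Rightarrow> nat \<Rightarrow> var set" where
  "block n i = {i} \<times> {..<n i}"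

definition vars :: "nat \<Rightarrow> (nat \<Rightarrow> nat) \<Rightarrow> var set" where
  "vars N n = (SIGMA i:{..<N}. {..<n i})"

definition con_monoms :: "(nat \<Rightarrow> nat) \<Rightarrow> nat \<Rightarrow> nat \<Rightarrow> var monom set" where
  "con_monoms n i D =
     {\<alpha>. Poly_Mapping.keys \<alpha> \<subseteq> block n i \<and> degree_in (block n i) \<alpha> \<le> D}"

definition obj_monoms :: "nat \<Rightarrow> (nat \<Rightarrow> nat) \<Rightarrow> (nat \<Rightarrow> nat) \<Rightarrow> var monom set" where
  "obj_monoms N n b =
     {\<alpha>. Poly_Mapping.keys \<alpha> \<subseteq> vars N n \<and> (\<forall>j<N. degree_in (block n j) \<alpha> \<le> b j)}"

text \<open>Complex solutions \<open>(x, \<mu>)\<close> of the KKT system with equality constraints only.\<close>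

definition kkt_system_solutions ::
  "nat \<Rightarrow> (nat \<Rightarrow> nat) \<Rightarrow> (nat \<Rightarrow> nat) \<Rightarrow> (nat \<Rightarrow> var rpoly) \<Rightarrow> (nat \<Rightarrow> nat \<Rightarrow> var rpoly)
    \<Rightarrow> ((var \<Rightarrow> complex) \<times> (nat \<times> nat \<Rightarrow> complex)) set" where
  "kkt_system_solutions N n m f g =
     {(x, \<mu>). x \<in> vars N n \<rightarrow>\<^sub>E UNIV \<and> \<mu> \<in> (SIGMA i:{..<N}. {..<m i}) \<rightarrow>\<^sub>E UNIV \<and>
        (\<forall>i<N. \<forall>v\<in>block n i.
           (\<Sum>j<m i. \<mu> (i, j) * poly_eval (pdiff v (g i j)) x) = poly_eval (pdiff v (f i)) x) \<and>
        (\<forall>i<N. \<forall>j<m i. poly_eval (g i j) x = 0)}"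

text \<open>KKT points of the problem in which \<open>E i\<close> and \<open>I i\<close> index the equality and the inequality
  constraints of player \<open>i\<close>.\<close>

definition kkt_points ::
  "nat \<Rightarrow> (nat \<Rightarrow> nat) \<Rightarrow> (nat \<Rightarrow> nat set) \<Rightarrow> (nat \<Rightarrow> nat set)
    \<Rightarrow> (nat \<Rightarrow> var rpoly) \<Rightarrow> (nat \<Rightarrow> nat \<Rightarrow> var rpoly) \<Rightarrow> (var \<Rightarrow> real) set" where
  "kkt_points N n E I f g =
     {x \<in> vars N n \<rightarrow>\<^sub>E UNIV.
        (\<forall>i<N. (\<forall>j\<in>E i. poly_eval (g i j) x = 0) \<and> (\<forall>j\<in>I i. poly_eval (g i j) x \<ge> 0)) \<and>
        (\<exists>\<mu> :: nat \<times> nat \<Rightarrow> real. \<forall>i<N.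
           (\<forall>v\<in>block n i.
              (\<Sum>j\<in>E i \<union> I i. \<mu> (i, j) * poly_eval (pdiff v (g i j)) x)
                = poly_eval (pdiff v (f i)) x) \<and>
           (\<forall>j\<in>I i. \<mu> (i, j) \<ge> 0 \<and> \<mu> (i, j) * poly_eval (g i j) x = 0))}"

text \<open>Index sets of the coefficients of all objectives and of all constraints, where \<open>a i j\<close>
  bounds the degree of \<open>f i\<close> in the block \<open>j\<close> and \<open>d i j\<close> bounds the degree of \<open>g i j\<close>.\<close>

definition obj_coeffs ::
  "nat \<Rightarrow> (nat \<Rightarrow> nat) \<Rightarrow> (nat \<Rightarrow> nat \<Rightarrow> nat) \<Rightarrow> (nat \<times> var monom) set" where
  "obj_coeffs N n a = (SIGMA i:{..<N}. obj_monoms N n (a i))"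

definition con_coeffs ::
  "nat \<Rightarrow> (nat \<Rightarrow> nat) \<Rightarrow> (nat \<Rightarrow> nat) \<Rightarrow> (nat \<Rightarrow> nat \<Rightarrow> nat) \<Rightarrow> ((nat \<times> nat) \<times> var monom) set" where
  "con_coeffs N n m d =
     (SIGMA (i, j):(SIGMA i:{..<N}. {..<m i}). con_monoms n i (d i j))"

text \<open>\<open>P f g\<close> holds for generic \<open>f\<close> and \<open>g\<close>: the coefficient vectors for which it fails are contained
  in a Borel null set, that is, they form a set of Lebesgue measure zero.\<close>

definition generic_polys ::
  "nat \<Rightarrow> (nat \<Rightarrow> nat) \<Rightarrow> (nat \<Rightarrow> nat) \<Rightarrow> (nat \<Rightarrow> nat \<Rightarrow> nat) \<Rightarrow> (nat \<Rightarrow> nat \<Rightarrow> nat)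
    \<Rightarrow> ((nat \<Rightarrow> var rpoly) \<Rightarrow> (nat \<Rightarrow> nat \<Rightarrow> var rpoly) \<Rightarrow> bool) \<Rightarrow> bool" where
  "generic_polys N n m a d P \<longleftrightarrow>
     (AE (u, w) in (\<Pi>\<^sub>M k\<in>obj_coeffs N n a. lborel) \<Otimes>\<^sub>M (\<Pi>\<^sub>M k\<in>con_coeffs N n m d. lborel).
        P (\<lambda>i. poly_of_coeffs (obj_monoms N n (a i)) (\<lambda>\<alpha>. u (i, \<alpha>)))
          (\<lambda>i j. poly_of_coeffs (con_monoms n i (d i j)) (\<lambda>\<alpha>. w ((i, j), \<alpha>))))"


lemma finite_block [simp]: "finite (block n i)"
  by (simp add: block_def)

lemma finite_vars [simp]: "finite (vars N n)"
  by (simp add: vars_def)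

lemma lookup_le_degree_in:
  "finite S \<Longrightarrow> v \<in> S \<Longrightarrow> Poly_Mapping.lookup \<alpha> v \<le> degree_in S \<alpha>"
  unfolding degree_in_def by (rule member_le_sum) auto

lemma finite_con_monoms [simp]: "finite (con_monoms n i D)"
  unfolding con_monoms_def
  by (rule finite_subset[OF _ finite_monoms[of "block n i" D]])
     (auto intro: order_trans[OF lookup_le_degree_in[OF finite_block]])

lemma finite_obj_monoms [simp]: "finite (obj_monoms N n b)"
proof (rule finite_subset[OF _ finite_monoms[of "vars N n" "\<Sum>j<N. b j"]])
  show "obj_monoms N n b \<subseteq> {\<alpha>. Poly_Mapping.keys \<alpha> \<subseteq> vars N n \<and>
          (\<forall>v\<in>vars N n. Poly_Mapping.lookup \<alpha> v \<le> (\<Sum>j<N. b j))}"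
  proof safe
    fix \<alpha> j k
    assume \<alpha>: "\<alpha> \<in> obj_monoms N n b" and "(j, k) \<in> vars N n"
    then have jk: "j < N" "(j, k) \<in> block n j"
      by (auto simp: vars_def block_def)
    have "Poly_Mapping.lookup \<alpha> (j, k) \<le> degree_in (block n j) \<alpha>"
      using jk by (intro lookup_le_degree_in) auto
    also have "\<dots> \<le> b j"
      using \<alpha> jk by (simp add: obj_monoms_def)
    also have "\<dots> \<le> (\<Sum>j<N. b j)"
      using jk by (intro member_le_sum) auto
    finally show "Poly_Mapping.lookup \<alpha> (j, k) \<le> (\<Sum>j<N. b j)" .
  qed (auto simp: obj_monoms_def)
qed auto

lemma finite_obj_coeffs [simp]: "finite (obj_coeffs N n a)"
  by (auto simp: obj_coeffs_def)

lemma finite_con_coeffs [simp]: "finite (con_coeffs N n m d)"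
  by (auto simp: con_coeffs_def)

end

theory Submission
  imports Defs
begin

text \<open>The stationarity equation of player \<open>i\<close> for the coordinate \<open>v\<close> can be solved for the
  coefficient of the linear monomial \<open>v\<close> in \<open>f i\<close>, and the equation \<open>g i j = 0\<close> for the constant
  coefficient of \<open>g i j\<close>. So the unknowns \<open>(x, \<mu>)\<close> together with the remaining coefficients are
  mapped polynomially to the vector of all coefficients, the solutions form a fibre of this map, and
  both spaces have the same dimension \<open>D\<close>. Since \<open>D + 1\<close> polynomials in \<open>D\<close> variables are
  algebraically dependent, each unknown satisfies a nontrivial polynomial relation with the
  components of the map. If some coefficient of this relation, viewed as a polynomial in the unknown,
  does not vanish at the given coefficient vector, then the unknown takes only finitely many values
  on the fibre; and a nonzero polynomial vanishes only on a null set. A KKT point solves the equality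
  system of its active constraints, and there are finitely many active sets.\<close>


section \<open>Algebraic dependence of polynomials\<close>

lemma monom_eval_add: "monom_eval (\<alpha> + \<beta>) x = monom_eval \<alpha> x * monom_eval \<beta> x"
proof -
  let ?S = "Poly_Mapping.keys \<alpha> \<union> Poly_Mapping.keys \<beta>"
  have "monom_eval (\<alpha> + \<beta>) x = (\<Prod>v\<in>?S. x v ^ Poly_Mapping.lookup (\<alpha> + \<beta>) v)"
    by (rule monom_eval_superset) (auto dest: subsetD[OF Poly_Mapping.keys_add])
  then show ?thesis
    by (simp add: monom_eval_superset[of ?S] lookup_add power_add prod.distrib)
qed

lemma poly_eq_sum_single:
  "p = (\<Sum>\<alpha>\<in>Poly_Mapping.keys p. Poly_Mapping.single \<alpha> (Poly_Mapping.lookup p \<alpha>))"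
proof (rule poly_mapping_eqI)
  fix \<beta>
  have "(\<Sum>\<alpha>\<in>Poly_Mapping.keys p. if \<alpha> = \<beta> then Poly_Mapping.lookup p \<alpha> else 0)
      = Poly_Mapping.lookup p \<beta>"
    by (subst sum.delta) (auto simp: in_keys_iff)
  then show "Poly_Mapping.lookup p \<beta> =
      Poly_Mapping.lookup (\<Sum>\<alpha>\<in>Poly_Mapping.keys p.
        Poly_Mapping.single \<alpha> (Poly_Mapping.lookup p \<alpha>)) \<beta>"
    by (simp add: lookup_sum lookup_single when_def)
qed

lemma poly_eval_mult: "poly_eval (p * q) x = poly_eval p x * poly_eval q x"
proof -
  let ?s = "\<lambda>p \<alpha>. Poly_Mapping.single \<alpha> (Poly_Mapping.lookup p \<alpha>)"
  have "p * q = (\<Sum>\<alpha>\<in>Poly_Mapping.keys p. \<Sum>\<beta>\<in>Poly_Mapping.keys q. ?s p \<alpha> * ?s q \<beta>)"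
    by (subst (1 2) poly_eq_sum_single) (simp only: sum_product)
  then have "poly_eval (p * q) x
      = (\<Sum>\<alpha>\<in>Poly_Mapping.keys p. \<Sum>\<beta>\<in>Poly_Mapping.keys q.
          (of_real (Poly_Mapping.lookup p \<alpha>) * monom_eval \<alpha> x) *
          (of_real (Poly_Mapping.lookup q \<beta>) * monom_eval \<beta> x))"
    by (simp add: poly_eval_sum mult_single poly_eval_single monom_eval_add mult_ac)
  also have "\<dots> = poly_eval p x * poly_eval q x"
    unfolding poly_eval_def sum_product ..
  finally show ?thesis .
qed

lemma poly_eval_1 [simp]: "poly_eval 1 x = 1"
  using poly_eval_single[of 0 1 x] by (simp add: single_one monom_eval_def)

lemma poly_eval_power: "poly_eval (p ^ k) x = poly_eval p x ^ k"
  by (induction k) (simp_all add: poly_eval_mult)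

lemma poly_eval_prod: "poly_eval (\<Prod>a\<in>A. p a) x = (\<Prod>a\<in>A. poly_eval (p a) x)"
  by (induction A rule: infinite_finite_induct) (auto simp: poly_eval_mult)

text \<open>Bounding each exponent separately, rather than the total degree, makes these sets easy
  to count, and the bounds add up when polynomials are multiplied.\<close>

definition monoms_le :: "'v set \<Rightarrow> nat \<Rightarrow> 'v monom set" where
  "monoms_le V D = {\<alpha>. Poly_Mapping.keys \<alpha> \<subseteq> V \<and> (\<forall>v\<in>V. Poly_Mapping.lookup \<alpha> v \<le> D)}"

lemma finite_monoms_le: "finite V \<Longrightarrow> finite (monoms_le V D)"
  unfolding monoms_le_def by (rule finite_monoms)

lemma card_monoms_le:
  assumes "finite V"
  shows "card (monoms_le V D) \<le> (D + 1) ^ card V"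
proof -
  let ?r = "\<lambda>\<alpha>. restrict (Poly_Mapping.lookup \<alpha>) V"
  have "inj_on ?r (monoms_le V D)"
  proof (rule inj_onI, rule poly_mapping_eqI)
    fix \<alpha> \<beta> v
    assume "\<alpha> \<in> monoms_le V D" "\<beta> \<in> monoms_le V D" and eq: "?r \<alpha> = ?r \<beta>"
    then have "v \<notin> V \<Longrightarrow> Poly_Mapping.lookup \<alpha> v = 0 \<and> Poly_Mapping.lookup \<beta> v = 0"
      by (auto simp: monoms_le_def in_keys_iff)
    then show "Poly_Mapping.lookup \<alpha> v = Poly_Mapping.lookup \<beta> v"
      using fun_cong[OF eq, of v] by (cases "v \<in> V") auto
  qed
  then have "card (monoms_le V D) \<le> card (V \<rightarrow>\<^sub>E {..D})"
    by (rule card_inj_on_le) (auto simp: monoms_le_def assms finite_PiE)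
  then show ?thesis
    by (simp add: card_PiE assms)
qed

lemma keys_subset_monoms_le:
  assumes "\<And>\<alpha>. \<alpha> \<in> Poly_Mapping.keys p \<Longrightarrow> Poly_Mapping.keys \<alpha> \<subseteq> V"
  obtains D where "Poly_Mapping.keys p \<subseteq> monoms_le V D"
proof
  let ?D = "\<Sum>\<alpha>\<in>Poly_Mapping.keys p. degree_in (Poly_Mapping.keys \<alpha>) \<alpha>"
  show "Poly_Mapping.keys p \<subseteq> monoms_le V ?D"
  proof
    fix \<alpha> assume \<alpha>: "\<alpha> \<in> Poly_Mapping.keys p"
    have "Poly_Mapping.lookup \<alpha> v \<le> ?D" for v
    proof (cases "v \<in> Poly_Mapping.keys \<alpha>")
      case True
      then have "Poly_Mapping.lookup \<alpha> v \<le> degree_in (Poly_Mapping.keys \<alpha>) \<alpha>"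
        by (intro lookup_le_degree_in) auto
      also have "\<dots> \<le> ?D"
        using \<alpha> by (intro member_le_sum) auto
      finally show ?thesis .
    qed (simp add: in_keys_iff)
    with assms[OF \<alpha>] show "\<alpha> \<in> monoms_le V ?D"
      by (simp add: monoms_le_def)
  qed
qed

lemma monoms_le_mono: "D \<le> D' \<Longrightarrow> monoms_le V D \<subseteq> monoms_le V D'"
  by (force simp: monoms_le_def)

lemma keys_mult_monoms_le:
  assumes "Poly_Mapping.keys p \<subseteq> monoms_le V D" "Poly_Mapping.keys q \<subseteq> monoms_le V D'"
  shows "Poly_Mapping.keys (p * q) \<subseteq> monoms_le V (D + D')"
proof
  fix \<gamma> assume "\<gamma> \<in> Poly_Mapping.keys (p * q)"
  then obtain \<alpha> \<beta> where "\<gamma> = \<alpha> + \<beta>" "\<alpha> \<in> Poly_Mapping.keys p" "\<beta> \<in> Poly_Mapping.keys q"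
    using keys_mult[of p q] by auto
  moreover from this have "\<alpha> \<in> monoms_le V D" "\<beta> \<in> monoms_le V D'"
    using assms by auto
  ultimately show "\<gamma> \<in> monoms_le V (D + D')"
    using Poly_Mapping.keys_add[of \<alpha> \<beta>] by (auto simp: monoms_le_def lookup_add add_mono)
qed

lemma keys_power_monoms_le:
  assumes "Poly_Mapping.keys p \<subseteq> monoms_le V D"
  shows "Poly_Mapping.keys (p ^ k) \<subseteq> monoms_le V (k * D)"
proof (induction k)
  case 0
  then show ?case by (simp add: monoms_le_def)
next
  case (Suc k)
  then show ?case
    using keys_mult_monoms_le[OF assms Suc.IH] by simp
qed

lemma keys_prod_monoms_le:
  assumes "finite A" "\<And>a. a \<in> A \<Longrightarrow> Poly_Mapping.keys (p a) \<subseteq> monoms_le V D"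
  shows "Poly_Mapping.keys (\<Prod>a\<in>A. p a) \<subseteq> monoms_le V (card A * D)"
  using assms
proof (induction A rule: finite_induct)
  case empty
  then show ?case by (simp add: monoms_le_def)
next
  case (insert a A)
  then show ?case
    using keys_mult_monoms_le[of "p a" V D "\<Prod>a\<in>A. p a" "card A * D"] by simp
qed

text \<open>Gaussian elimination, by induction on the equations: a pivot removes one equation
  together with one unknown, and an equation without a pivot holds trivially.\<close>

lemma homogeneous_system_nontrivial:
  fixes M :: "'i \<Rightarrow> 'j \<Rightarrow> 'a::field"
  assumes "finite J" "finite I" "card J < card I"
  obtains c where "\<exists>i\<in>I. c i \<noteq> 0" "\<And>j. j \<in> J \<Longrightarrow> (\<Sum>i\<in>I. c i * M i j) = 0"
proof -
  have "\<exists>c. (\<exists>i\<in>I. c i \<noteq> 0) \<and> (\<forall>j\<in>J. (\<Sum>i\<in>I. c i * M i j) = 0)"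
    using assms
  proof (induction J arbitrary: I M rule: finite_induct)
    case empty
    then obtain i where "i \<in> I" by fastforce
    then show ?case by (intro exI[of _ "\<lambda>_. 1"]) auto
  next
    case (insert j0 J)
    show ?case
    proof (cases "\<forall>i\<in>I. M i j0 = 0")
      case True
      have "card J < card I"
        using insert.hyps insert.prems by simp
      then obtain c where "\<exists>i\<in>I. c i \<noteq> 0" "\<forall>j\<in>J. (\<Sum>i\<in>I. c i * M i j) = 0"
        using insert.IH[OF insert.prems(1)] by blast
      with True show ?thesis by (intro exI[of _ c]) auto
    next
      case False
      then obtain i0 where i0: "i0 \<in> I" "M i0 j0 \<noteq> 0" by auto
      let ?I = "I - {i0}"
      define r where "r = (\<lambda>i. M i j0 / M i0 j0)"
      have "card J < card ?I" "finite ?I"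
        using insert.hyps insert.prems i0 by auto
      then obtain c where c: "\<exists>i\<in>?I. c i \<noteq> 0"
          "\<forall>j\<in>J. (\<Sum>i\<in>?I. c i * (M i j - r i * M i0 j)) = 0"
        using insert.IH[of ?I "\<lambda>i j. M i j - r i * M i0 j"] by blast
      \<comment> \<open>The eliminated unknown gets the value that equation \<open>j0\<close>
        forces; by the choice of \<open>r\<close>, every bracket of the reduced system vanishes at
        \<open>j0\<close>.\<close>
      define c' where "c' = c(i0 := - (\<Sum>i\<in>?I. c i * r i))"
      have *: "(\<Sum>i\<in>I. c' i * M i j) = (\<Sum>i\<in>?I. c i * (M i j - r i * M i0 j))" for j
      proof -
        have "(\<Sum>i\<in>I. c' i * M i j) = c' i0 * M i0 j + (\<Sum>i\<in>?I. c' i * M i j)"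
          using insert.prems i0 by (intro sum.remove)
        also have "(\<Sum>i\<in>?I. c' i * M i j) = (\<Sum>i\<in>?I. c i * M i j)"
          by (rule sum.cong) (auto simp: c'_def)
        finally have "(\<Sum>i\<in>I. c' i * M i j)
            = - (\<Sum>i\<in>?I. c i * r i) * M i0 j + (\<Sum>i\<in>?I. c i * M i j)"
          by (simp only: c'_def fun_upd_same)
        then show ?thesis
          by (simp add: sum_distrib_right sum_subtractf right_diff_distrib mult.assoc)
      qed
      have "\<forall>j\<in>insert j0 J. (\<Sum>i\<in>I. c' i * M i j) = 0"
        unfolding * using c(2) i0 by (simp add: r_def)
      moreover have "\<exists>i\<in>I. c' i \<noteq> 0"
        using c(1) by (auto simp: c'_def)
      ultimately show ?thesis by blast
    qed
  qed
  with that show ?thesis by blast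
qed

text \<open>If \<open>F\<close> consists of at least as many polynomials as there are variables, then \<open>T\<close> is
  algebraic over \<open>F\<close>: as \<open>K\<close> grows, the number of products of powers at most \<open>K\<close>
  eventually exceeds the number of monomials that occur in them.\<close>

lemma algebraic_relation:
  fixes F :: "'c \<Rightarrow> 'w rpoly"
  assumes C: "finite C" and W: "finite W" "card W \<le> card C"
    and F: "\<And>c \<alpha>. c \<in> C \<Longrightarrow> \<alpha> \<in> Poly_Mapping.keys (F c) \<Longrightarrow> Poly_Mapping.keys \<alpha> \<subseteq> W"
    and T: "\<And>\<alpha>. \<alpha> \<in> Poly_Mapping.keys T \<Longrightarrow> Poly_Mapping.keys \<alpha> \<subseteq> W"
  obtains K r where "\<exists>k\<le>K. \<exists>e\<in>C \<rightarrow>\<^sub>E {..K}. r k e \<noteq> 0"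
    and "\<And>z :: 'w \<Rightarrow> 'a::real_normed_field.
      (\<Sum>k\<le>K. (\<Sum>e\<in>C \<rightarrow>\<^sub>E {..K}. of_real (r k e) * (\<Prod>c\<in>C. poly_eval (F c) z ^ e c)) *
         poly_eval T z ^ k) = 0"
proof -
  have "\<forall>c. \<exists>D. c \<in> C \<longrightarrow> Poly_Mapping.keys (F c) \<subseteq> monoms_le W D"
    using F keys_subset_monoms_le by metis
  then obtain DF where DF: "\<And>c. c \<in> C \<Longrightarrow> Poly_Mapping.keys (F c) \<subseteq> monoms_le W (DF c)"
    by metis
  obtain DT where DT: "Poly_Mapping.keys T \<subseteq> monoms_le W DT"
    using T keys_subset_monoms_le by metis
  \<comment> \<open>\<open>Suc\<close> makes \<open>D\<close> positive, which absorbs the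
    \<open>+ 1\<close> in the count of monomials below.\<close>
  define D where "D = Suc (DT + (\<Sum>c\<in>C. DF c))"
  have DF': "Poly_Mapping.keys (F c) \<subseteq> monoms_le W D" if "c \<in> C" for c
  proof -
    have "DF c \<le> (\<Sum>c\<in>C. DF c)"
      using that C by (intro member_le_sum) auto
    then show ?thesis
      using DF[OF that] monoms_le_mono[of "DF c" D W] by (auto simp: D_def)
  qed
  have DT': "Poly_Mapping.keys T \<subseteq> monoms_le W D"
    using DT monoms_le_mono[of DT D W] by (auto simp: D_def)
  define s where "s = card C"
  \<comment> \<open>With this \<open>K\<close> there are at most \<open>K * (K + 1) ^ s\<close>
    monomials, fewer than the \<open>(K + 1) ^ Suc s\<close> products.\<close>
  define K where "K = (Suc s * D) ^ s"
  define I where "I = {..K} \<times> (C \<rightarrow>\<^sub>E {..K})"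
  \<comment> \<open>A product has \<open>Suc s\<close> factors, a power of \<open>T\<close> and one
    of each \<open>F c\<close>, and each factor has exponents at most \<open>K * D\<close>.\<close>
  define J where "J = monoms_le W (Suc s * (K * D))"
  define P where "P = (\<lambda>(k, e). T ^ k * (\<Prod>c\<in>C. F c ^ e c))"
  have P: "Poly_Mapping.keys (P i) \<subseteq> J" if "i \<in> I" for i
  proof -
    obtain k e where i: "i = (k, e)" "k \<le> K" "e \<in> C \<rightarrow>\<^sub>E {..K}"
      using \<open>i \<in> I\<close> by (auto simp: I_def)
    have 1: "Poly_Mapping.keys (T ^ k) \<subseteq> monoms_le W (K * D)"
      using keys_power_monoms_le[OF DT', of k] monoms_le_mono[of "k * D" "K * D" W] i by auto
    have "Poly_Mapping.keys (F c ^ e c) \<subseteq> monoms_le W (K * D)" if "c \<in> C" for c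
    proof -
      have "e c \<le> K" using i that by auto
      then show ?thesis
        using keys_power_monoms_le[OF DF'[OF that], of "e c"]
          monoms_le_mono[of "e c * D" "K * D" W] by auto
    qed
    with C have "Poly_Mapping.keys (\<Prod>c\<in>C. F c ^ e c) \<subseteq> monoms_le W (s * (K * D))"
      unfolding s_def by (intro keys_prod_monoms_le)
    from keys_mult_monoms_le[OF 1 this] show ?thesis
      by (simp add: i P_def J_def)
  qed
  have fin: "finite I" "finite J"
    by (simp_all add: I_def J_def finite_PiE C finite_monoms_le W)
  have "card J \<le> (Suc s * (K * D) + 1) ^ card W"
    unfolding J_def by (rule card_monoms_le) fact
  also have "\<dots> \<le> (Suc s * (K * D) + 1) ^ s"
    using W by (intro power_increasing) (auto simp: s_def)
  also have "\<dots> \<le> (Suc s * D * (K + 1)) ^ s"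
    by (intro power_mono) (auto simp: algebra_simps D_def)
  also have "\<dots> = K * (K + 1) ^ s"
    by (simp only: power_mult_distrib K_def)
  also have "\<dots> < (K + 1) ^ Suc s"
    by simp
  also have "\<dots> = card I"
    by (simp add: I_def card_cartesian_product card_PiE C s_def)
  finally have "card J < card I" .
  \<comment> \<open>One unknown per product and one equation per monomial: a solution makes the
    combination of the products vanish coefficientwise, hence at every point
    \<open>z\<close>.\<close>
  then obtain c where c: "\<exists>i\<in>I. c i \<noteq> 0"
      "\<And>\<beta>. \<beta> \<in> J \<Longrightarrow> (\<Sum>i\<in>I. c i * Poly_Mapping.lookup (P i) \<beta>) = 0"
    using homogeneous_system_nontrivial[OF fin(2,1), of "\<lambda>i \<beta>. Poly_Mapping.lookup (P i) \<beta>"]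
    by metis
  show ?thesis
  proof
    show "\<exists>k\<le>K. \<exists>e\<in>C \<rightarrow>\<^sub>E {..K}. c (k, e) \<noteq> 0"
      using c(1) by (auto simp: I_def)
    fix z :: "'w \<Rightarrow> 'a"
    have "(\<Sum>k\<le>K. (\<Sum>e\<in>C \<rightarrow>\<^sub>E {..K}. of_real (c (k, e)) * (\<Prod>c\<in>C. poly_eval (F c) z ^ e c)) *
          poly_eval T z ^ k)
        = (\<Sum>i\<in>I. of_real (c i) * poly_eval (P i) z)"
      unfolding I_def sum.cartesian_product'
      by (simp add: P_def poly_eval_mult poly_eval_power poly_eval_prod sum_distrib_left mult_ac)
    also have "\<dots> = (\<Sum>i\<in>I. \<Sum>\<beta>\<in>J. of_real (c i) * (of_real (Poly_Mapping.lookup (P i) \<beta>) * monom_eval \<beta> z))"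
      using P by (intro sum.cong refl) (simp add: poly_eval_superset[OF fin(2)] sum_distrib_left)
    also have "\<dots> = (\<Sum>\<beta>\<in>J. of_real (\<Sum>i\<in>I. c i * Poly_Mapping.lookup (P i) \<beta>) * monom_eval \<beta> z)"
      by (subst sum.swap) (simp add: sum_distrib_left mult_ac)
    also have "\<dots> = 0"
      using c(2) by simp
    finally show "(\<Sum>k\<le>K. (\<Sum>e\<in>C \<rightarrow>\<^sub>E {..K}. of_real (c (k, e)) *
        (\<Prod>c\<in>C. poly_eval (F c) z ^ e c)) * poly_eval T z ^ k) = 0" .
  qed
qed

section \<open>Zero sets of polynomials are null sets\<close>

lemma sum_PiE_insert:
  assumes "c \<notin> C"
  shows "(\<Sum>e\<in>insert c C \<rightarrow>\<^sub>E A. f e) = (\<Sum>k\<in>A. \<Sum>e\<in>C \<rightarrow>\<^sub>E A. f (e(c := k)))"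
proof -
  have "(\<Sum>e\<in>insert c C \<rightarrow>\<^sub>E A. f e) = (\<Sum>(k, e)\<in>A \<times> (C \<rightarrow>\<^sub>E A). f (e(c := k)))"
    unfolding PiE_insert_eq
    by (subst sum.reindex[OF inj_combinator[OF assms, of "\<lambda>_. A"]]) (simp add: case_prod_beta' comp_def)
  then show ?thesis
    by (simp add: sum.cartesian_product)
qed

lemma AE_lborel_polyfun_nonzero:
  fixes b :: "nat \<Rightarrow> real"
  assumes "k \<le> K" "b k \<noteq> 0"
  shows "AE t in lborel. (\<Sum>k\<le>K. b k * t ^ k) \<noteq> 0"
proof -
  have "{t. (\<Sum>k\<le>K. b k * t ^ k) = 0} \<in> null_sets lborel"
    using assms by (intro finite_imp_null_set_lborel) (auto simp: polyfun_finite_roots)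
  then show ?thesis
    by (rule AE_I') auto
qed

text \<open>Induction on the variables and Fubini: seen as a polynomial in the new variable, the sum
  has a coefficient that is a nonzero polynomial in the others. Wherever that coefficient does not
  vanish, only finitely many values of the new variable are roots.\<close>

lemma AE_PiM_lborel_poly_nonzero:
  fixes r :: "('c \<Rightarrow> nat) \<Rightarrow> real"
  assumes "finite C" "e \<in> C \<rightarrow>\<^sub>E {..K}" "r e \<noteq> 0"
  shows "AE y in \<Pi>\<^sub>M c\<in>C. lborel. (\<Sum>e\<in>C \<rightarrow>\<^sub>E {..K}. r e * (\<Prod>c\<in>C. y c ^ e c)) \<noteq> 0"
  using assms
proof (induction C arbitrary: r e rule: finite_induct)
  case empty
  then show ?case by simp
next
  case (insert c C)
  interpret product_sigma_finite "\<lambda>_ :: 'c. lborel :: real measure"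
    by standard
  define p where "p = (\<lambda>y. \<Sum>e\<in>insert c C \<rightarrow>\<^sub>E {..K}. r e * (\<Prod>c\<in>insert c C. y c ^ e c))"
  have [measurable]: "p \<in> borel_measurable (\<Pi>\<^sub>M c\<in>insert c C. lborel)"
    unfolding p_def by measurable
  define q where "q = (\<lambda>k y. \<Sum>e\<in>C \<rightarrow>\<^sub>E {..K}. r (e(c := k)) * (\<Prod>c\<in>C. y c ^ e c))"
  have p: "p (y(c := t)) = (\<Sum>k\<le>K. q k y * t ^ k)" for y t
  proof -
    have "(\<Prod>d\<in>insert c C. (y(c := t)) d ^ (e(c := k)) d) = t ^ k * (\<Prod>d\<in>C. y d ^ e d)" for e k
    proof -
      have "(\<Prod>d\<in>C. (y(c := t)) d ^ (e(c := k)) d) = (\<Prod>d\<in>C. y d ^ e d)"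
        using insert.hyps by (intro prod.cong) auto
      then show ?thesis
        using insert.hyps by simp
    qed
    then show ?thesis
      unfolding p_def sum_PiE_insert[OF insert.hyps(2)] q_def sum_distrib_right
      by (simp add: mult_ac)
  qed
  \<comment> \<open>The witness \<open>e\<close> splits into its exponent at \<open>c\<close> and
    the remaining ones, so \<open>q (e c)\<close> inherits a nonzero coefficient.\<close>
  have "restrict e C \<in> C \<rightarrow>\<^sub>E {..K}"
    using insert.prems(1) by auto
  moreover have "(restrict e C)(c := e c) = e"
    using insert.prems(1) insert.hyps(2) by (auto simp: restrict_def fun_eq_iff PiE_def extensional_def)
  then have "r ((restrict e C)(c := e c)) \<noteq> 0"
    using insert.prems(2) by metis
  ultimately have "AE y in \<Pi>\<^sub>M c\<in>C. lborel. q (e c) y \<noteq> 0"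
    unfolding q_def by (rule insert.IH)
  \<comment> \<open>Measure zero becomes the vanishing of the integral of an indicator, which can be
    computed one variable at a time.\<close>
  then have "AE y in \<Pi>\<^sub>M c\<in>C. lborel. (\<integral>\<^sup>+ t. indicator {y. p y = 0} (y(c := t)) \<partial>lborel) = 0"
  proof eventually_elim
    case (elim y)
    have "AE t in lborel. p (y(c := t)) \<noteq> 0"
      unfolding p using insert.prems(1) elim by (intro AE_lborel_polyfun_nonzero[of "e c"]) auto
    then have "(\<integral>\<^sup>+ t. indicator {y. p y = 0} (y(c := t)) \<partial>lborel) = (\<integral>\<^sup>+ t. 0 \<partial>(lborel :: real measure))"
      by (intro nn_integral_cong_AE) (auto elim!: eventually_mono)
    then show ?case by simp
  qed
  then have "(\<integral>\<^sup>+ y. indicator {y. p y = 0} y \<partial>(\<Pi>\<^sub>M c\<in>insert c C. lborel)) = 0"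
    using insert.hyps
    by (subst product_nn_integral_insert) (auto simp: nn_integral_cong_AE[of _ "\<lambda>_. 0"])
  then have "AE y in \<Pi>\<^sub>M c\<in>insert c C. lborel. p y \<noteq> 0"
    by (subst AE_iff_nn_integral) auto
  then show ?case
    unfolding p_def .
qed

section \<open>Product measures over disjoint unions of index sets\<close>

lemma measurable_case_sum_PiM:
  "(\<lambda>(u, w). case_sum u w) \<in>
    measurable ((\<Pi>\<^sub>M k\<in>A. M) \<Otimes>\<^sub>M (\<Pi>\<^sub>M k\<in>B. M)) (\<Pi>\<^sub>M k\<in>A <+> B. M)"
    (is "?f \<in> measurable ?Q ?P")
proof (rule measurable_PiM_single')
  show "(\<lambda>x. ?f x k) \<in> measurable ?Q M" if "k \<in> A <+> B" for k
    using that by (auto simp: case_prod_beta')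
  show "?f \<in> space ?Q \<rightarrow> (\<Pi>\<^sub>E k\<in>A <+> B. space M)"
    by (auto simp: space_pair_measure space_PiM PiE_def extensional_def split: sum.splits)
qed

text \<open>A box over the union pulls back to a product of two boxes, so both measures agree on
  boxes, which determine the product measure. This merges the coefficients of objectives and
  constraints into the single vector that the fibre argument requires.\<close>

lemma PiM_Plus_eq_distr:
  fixes A :: "'a set" and B :: "'b set"
  assumes M: "sigma_finite_measure M" and fin: "finite A" "finite B"
  shows "(\<Pi>\<^sub>M k\<in>A <+> B. M)
    = distr ((\<Pi>\<^sub>M k\<in>A. M) \<Otimes>\<^sub>M (\<Pi>\<^sub>M k\<in>B. M)) (\<Pi>\<^sub>M k\<in>A <+> B. M) (\<lambda>(u, w). case_sum u w)"
    (is "?P = distr ?Q ?P ?f")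
proof -
  interpret A: product_sigma_finite "\<lambda>_ :: 'a. M" by (intro product_sigma_finite.intro M)
  interpret B: product_sigma_finite "\<lambda>_ :: 'b. M" by (intro product_sigma_finite.intro M)
  interpret AB: product_sigma_finite "\<lambda>_ :: 'a + 'b. M" by (intro product_sigma_finite.intro M)
  interpret B': sigma_finite_measure "\<Pi>\<^sub>M k\<in>B. M"
    by (rule B.sigma_finite) fact
  show ?thesis
  proof (rule AB.PiM_eqI[symmetric])
    fix X :: "'a + 'b \<Rightarrow> _" assume X: "\<And>k. k \<in> A <+> B \<Longrightarrow> X k \<in> sets M"
    have XA: "X (Inl k) \<in> sets M" if "k \<in> A" for k
      using X[of "Inl k"] that by auto
    have XB: "X (Inr k) \<in> sets M" if "k \<in> B" for k
      using X[of "Inr k"] that by auto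
    let ?XA = "\<Pi>\<^sub>E k\<in>A. X (Inl k)" and ?XB = "\<Pi>\<^sub>E k\<in>B. X (Inr k)"
    have vimage: "?f -` (Pi\<^sub>E (A <+> B) X) \<inter> space ?Q = ?XA \<times> ?XB"
    proof -
      have "X (Inl k) \<subseteq> space M" if "k \<in> A" for k
        using XA[OF that] by (rule sets.sets_into_space)
      moreover have "X (Inr k) \<subseteq> space M" if "k \<in> B" for k
        using XB[OF that] by (rule sets.sets_into_space)
      ultimately show ?thesis
        by (fastforce simp: space_pair_measure space_PiM PiE_iff extensional_def split: sum.splits)
    qed
    have "emeasure (distr ?Q ?P ?f) (Pi\<^sub>E (A <+> B) X) = emeasure ?Q (?XA \<times> ?XB)"
      using X fin by (subst emeasure_distr[OF measurable_case_sum_PiM])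
        (auto simp: vimage intro!: sets_PiM_I_finite)
    also have "\<dots> = emeasure (\<Pi>\<^sub>M k\<in>A. M) ?XA * emeasure (\<Pi>\<^sub>M k\<in>B. M) ?XB"
      using XA XB fin by (intro B'.emeasure_pair_measure_Times sets_PiM_I_finite) auto
    also have "\<dots> = (\<Prod>k\<in>A. emeasure M (X (Inl k))) * (\<Prod>k\<in>B. emeasure M (X (Inr k)))"
      using XA XB fin by (simp add: A.emeasure_PiM B.emeasure_PiM)
    also have "\<dots> = (\<Prod>k\<in>A <+> B. emeasure M (X k))"
      using fin by (simp add: prod.Plus)
    finally show "emeasure (distr ?Q ?P ?f) (Pi\<^sub>E (A <+> B) X) = (\<Prod>k\<in>A <+> B. emeasure M (X k))" .
  qed (use fin in auto)
qed

section \<open>Generic fibres of polynomial maps\<close>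

text \<open>Each coordinate is algebraic over the components of \<open>F\<close>. On the fibre over
  \<open>y\<close> the relation specializes to a univariate equation, nontrivial for almost all
  \<open>y\<close>; finitely many values for each coordinate leave finitely many points.\<close>

lemma generic_fibre_finite:
  fixes F :: "'c \<Rightarrow> 'w rpoly"
  assumes C: "finite C" and W: "finite W" "card W \<le> card C"
    and F: "\<And>c \<alpha>. c \<in> C \<Longrightarrow> \<alpha> \<in> Poly_Mapping.keys (F c) \<Longrightarrow> Poly_Mapping.keys \<alpha> \<subseteq> W"
  shows "AE y in \<Pi>\<^sub>M c\<in>C. lborel. finite {z \<in> W \<rightarrow>\<^sub>E (UNIV :: complex set).
           \<forall>c\<in>C. poly_eval (F c) z = of_real (y c)}"
proof -
  have "AE y in \<Pi>\<^sub>M c\<in>C. lborel.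
      finite {t. \<exists>z :: 'w \<Rightarrow> complex. t = z v \<and> (\<forall>c\<in>C. poly_eval (F c) z = of_real (y c))}"
    if v: "v \<in> W" for v
  proof -
    let ?T = "Poly_Mapping.single (Poly_Mapping.single v 1) 1 :: 'w rpoly"
    have T: "poly_eval ?T z = z v" for z :: "'w \<Rightarrow> complex"
      by (simp add: poly_eval_single monom_eval_def)
    obtain K r where r: "\<exists>k\<le>K. \<exists>e\<in>C \<rightarrow>\<^sub>E {..K}. r k e \<noteq> 0"
      and rel: "\<And>z :: 'w \<Rightarrow> complex.
        (\<Sum>k\<le>K. (\<Sum>e\<in>C \<rightarrow>\<^sub>E {..K}. of_real (r k e) * (\<Prod>c\<in>C. poly_eval (F c) z ^ e c)) *
           poly_eval ?T z ^ k) = 0"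
    proof (rule algebraic_relation[OF C W F])
      show "Poly_Mapping.keys \<alpha> \<subseteq> W" if "\<alpha> \<in> Poly_Mapping.keys ?T" for \<alpha>
        using that v by simp
    qed auto
    obtain k e where ke: "k \<le> K" "e \<in> C \<rightarrow>\<^sub>E {..K}" "r k e \<noteq> 0"
      using r by auto
    \<comment> \<open>These coefficients are real, so the exceptional \<open>y\<close> form a null
      set of real vectors although the fibre is complex.\<close>
    define b where "b = (\<lambda>y :: 'c \<Rightarrow> real. \<lambda>k. \<Sum>e\<in>C \<rightarrow>\<^sub>E {..K}. r k e * (\<Prod>c\<in>C. y c ^ e c))"
    have "AE y in \<Pi>\<^sub>M c\<in>C. lborel. b y k \<noteq> 0"
      unfolding b_def using C ke(2,3) by (rule AE_PiM_lborel_poly_nonzero)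
    then show ?thesis
    proof eventually_elim
      case (elim y)
      have "{t. \<exists>z :: 'w \<Rightarrow> complex. t = z v \<and> (\<forall>c\<in>C. poly_eval (F c) z = of_real (y c))}
          \<subseteq> {t. (\<Sum>k\<le>K. complex_of_real (b y k) * t ^ k) = 0}"
      proof safe
        fix z :: "'w \<Rightarrow> complex" assume "\<forall>c\<in>C. poly_eval (F c) z = of_real (y c)"
        then have "complex_of_real (b y k)
            = (\<Sum>e\<in>C \<rightarrow>\<^sub>E {..K}. of_real (r k e) * (\<Prod>c\<in>C. poly_eval (F c) z ^ e c))" for k
          by (simp add: b_def)
        then show "(\<Sum>k\<le>K. complex_of_real (b y k) * z v ^ k) = 0"
          using rel[of z, unfolded T] by simp
      qed
      moreover have "finite {t. (\<Sum>k\<le>K. complex_of_real (b y k) * t ^ k) = 0}"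
        using elim ke(1) by (auto simp: polyfun_finite_roots)
      ultimately show ?case
        by (rule finite_subset)
    qed
  qed
  then have "AE y in \<Pi>\<^sub>M c\<in>C. lborel. \<forall>v\<in>W.
      finite {t. \<exists>z :: 'w \<Rightarrow> complex. t = z v \<and> (\<forall>c\<in>C. poly_eval (F c) z = of_real (y c))}"
    using W(1) by (intro AE_finite_allI)
  then show ?thesis
  proof eventually_elim
    case (elim y)
    show ?case
      by (rule finite_subset[OF _ finite_PiE[OF W(1) elim[rule_format]]]) auto
  qed
qed

text \<open>Polynomiality as a property of functions: closure rules then handle the large
  expressions of the KKT equations without explicit coefficient vectors.\<close>

definition poly_on :: "'v set \<Rightarrow> (('v \<Rightarrow> 'a::real_normed_field) \<Rightarrow> 'a) \<Rightarrow> bool" where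
  "poly_on V h \<longleftrightarrow> (\<exists>p. (\<forall>\<alpha>\<in>Poly_Mapping.keys p. Poly_Mapping.keys \<alpha> \<subseteq> V) \<and> h = poly_eval p)"

lemma poly_on_var: "v \<in> V \<Longrightarrow> poly_on V (\<lambda>z. z v)"
  unfolding poly_on_def
  by (rule exI[of _ "Poly_Mapping.single (Poly_Mapping.single v 1) 1"])
     (auto simp: poly_eval_single monom_eval_def)

lemma poly_on_of_real: "poly_on V (\<lambda>z. of_real c)"
  unfolding poly_on_def
  by (rule exI[of _ "Poly_Mapping.single 0 c"]) (auto simp: poly_eval_single monom_eval_def)

lemma poly_on_of_nat: "poly_on V (\<lambda>z. of_nat k)"
  using poly_on_of_real[of V "of_nat k"] by simp

lemma poly_on_add:
  assumes "poly_on V h" "poly_on V h'"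
  shows "poly_on V (\<lambda>z. h z + h' z)"
proof -
  obtain p q where "\<forall>\<alpha>\<in>Poly_Mapping.keys p. Poly_Mapping.keys \<alpha> \<subseteq> V" "h = poly_eval p"
      "\<forall>\<alpha>\<in>Poly_Mapping.keys q. Poly_Mapping.keys \<alpha> \<subseteq> V" "h' = poly_eval q"
    using assms unfolding poly_on_def by blast
  then show ?thesis
    unfolding poly_on_def using Poly_Mapping.keys_add[of p q]
    by (intro exI[of _ "p + q"]) (auto simp: poly_eval_add)
qed

lemma poly_on_mult:
  assumes "poly_on V h" "poly_on V h'"
  shows "poly_on V (\<lambda>z. h z * h' z)"
proof -
  obtain p q where pq: "\<forall>\<alpha>\<in>Poly_Mapping.keys p. Poly_Mapping.keys \<alpha> \<subseteq> V" "h = poly_eval p"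
      "\<forall>\<alpha>\<in>Poly_Mapping.keys q. Poly_Mapping.keys \<alpha> \<subseteq> V" "h' = poly_eval q"
    using assms unfolding poly_on_def by blast
  have "Poly_Mapping.keys \<gamma> \<subseteq> V" if "\<gamma> \<in> Poly_Mapping.keys (p * q)" for \<gamma>
  proof -
    obtain \<alpha> \<beta> where "\<gamma> = \<alpha> + \<beta>" "\<alpha> \<in> Poly_Mapping.keys p" "\<beta> \<in> Poly_Mapping.keys q"
      using keys_mult[of p q] \<open>\<gamma> \<in> Poly_Mapping.keys (p * q)\<close> by auto
    then show ?thesis
      using Poly_Mapping.keys_add[of \<alpha> \<beta>] pq by blast
  qed
  with pq show ?thesis
    unfolding poly_on_def by (intro exI[of _ "p * q"]) (auto simp: poly_eval_mult)
qed

lemma poly_on_diff: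
  assumes "poly_on V h" "poly_on V h'"
  shows "poly_on V (\<lambda>z. h z - h' z)"
  using poly_on_add[OF assms(1) poly_on_mult[OF poly_on_of_real[of V "-1"] assms(2)]] by simp

lemma poly_on_power: "poly_on V h \<Longrightarrow> poly_on V (\<lambda>z. h z ^ k)"
  by (induction k) (use poly_on_of_nat[of V 1] in \<open>auto intro: poly_on_mult\<close>)

lemma poly_on_sum:
  "(\<And>i. i \<in> S \<Longrightarrow> poly_on V (h i)) \<Longrightarrow> poly_on V (\<lambda>z. \<Sum>i\<in>S. h i z)"
  by (induction S rule: infinite_finite_induct)
     (use poly_on_of_nat[of V 0] in \<open>auto intro: poly_on_add\<close>)

lemma poly_on_prod:
  "(\<And>i. i \<in> S \<Longrightarrow> poly_on V (h i)) \<Longrightarrow> poly_on V (\<lambda>z. \<Prod>i\<in>S. h i z)"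
  by (induction S rule: infinite_finite_induct)
     (use poly_on_of_nat[of V 1] in \<open>auto intro: poly_on_mult\<close>)

lemma poly_on_monom_eval:
  "(\<And>v. v \<in> Poly_Mapping.keys \<alpha> \<Longrightarrow> \<sigma> v \<in> V) \<Longrightarrow> poly_on V (\<lambda>z. monom_eval \<alpha> (\<lambda>v. z (\<sigma> v)))"
  unfolding monom_eval_def by (intro poly_on_prod poly_on_power poly_on_var)

lemma monom_eval_cong:
  "(\<And>v. v \<in> Poly_Mapping.keys \<alpha> \<Longrightarrow> x v = y v) \<Longrightarrow> monom_eval \<alpha> x = monom_eval \<alpha> y"
  unfolding monom_eval_def by (intro prod.cong) auto

lemma poly_on_cong:
  assumes "poly_on V h" "\<And>v. v \<in> V \<Longrightarrow> x v = y v"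
  shows "h x = h y"
proof -
  obtain p where p: "\<And>\<alpha>. \<alpha> \<in> Poly_Mapping.keys p \<Longrightarrow> Poly_Mapping.keys \<alpha> \<subseteq> V" "h = poly_eval p"
    using assms(1) unfolding poly_on_def by blast
  have "monom_eval \<alpha> x = monom_eval \<alpha> y" if "\<alpha> \<in> Poly_Mapping.keys p" for \<alpha>
    using p(1)[OF that] assms(2) by (intro monom_eval_cong) auto
  then show ?thesis
    by (simp add: p(2) poly_eval_def)
qed

text \<open>A system whose equations \<open>G v\<close> can be solved for distinct coefficients \<open>\<sigma> v\<close>, one for
  each unknown \<open>v\<close>, has finitely many solutions for almost all coefficient vectors: together with
  the remaining coefficients, the unknowns parametrize the coefficient space.\<close>

lemma generic_solutions_finite:
  fixes \<sigma> :: "'x \<Rightarrow> 'c" and G :: "'x \<Rightarrow> ('c + 'x \<Rightarrow> complex) \<Rightarrow> complex"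
  assumes fin: "finite C" "finite X" and inj: "inj_on \<sigma> X" and sub: "\<sigma> ` X \<subseteq> C"
    and G: "\<And>v. v \<in> X \<Longrightarrow> poly_on ((C - \<sigma> ` X) <+> X) (G v)"
  shows "AE y in \<Pi>\<^sub>M c\<in>C. lborel. finite {x \<in> X \<rightarrow>\<^sub>E UNIV.
           \<forall>v\<in>X. G v (case_sum (\<lambda>c. of_real (y c)) x) = of_real (y (\<sigma> v))}"
proof -
  let ?W = "(C - \<sigma> ` X) <+> X"
  obtain p where p: "\<And>v \<alpha>. v \<in> X \<Longrightarrow> \<alpha> \<in> Poly_Mapping.keys (p v) \<Longrightarrow> Poly_Mapping.keys \<alpha> \<subseteq> ?W"
      "\<And>v. v \<in> X \<Longrightarrow> G v = poly_eval (p v)"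
    using G unfolding poly_on_def by metis
  \<comment> \<open>A coefficient that is solved for is given by its equation; every other
    coefficient is a coordinate of the parameter space, so its component is a projection.\<close>
  define F where "F = (\<lambda>c. if c \<in> \<sigma> ` X then p (inv_into X \<sigma> c)
    else Poly_Mapping.single (Poly_Mapping.single (Inl c) 1) 1)"
  have "card ?W = card (C - \<sigma> ` X) + card (\<sigma> ` X)"
    using fin inj by (simp add: card_Plus card_image)
  also have "\<dots> = card C"
    using fin sub by (simp add: card_Diff_subset card_mono)
  finally have "card ?W \<le> card C" by simp
  moreover have "Poly_Mapping.keys \<alpha> \<subseteq> ?W" if "c \<in> C" "\<alpha> \<in> Poly_Mapping.keys (F c)" for c \<alpha>
    using that p(1)[of "inv_into X \<sigma> c" \<alpha>] by (auto simp: F_def inv_into_into split: if_splits)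
  ultimately have "AE y in \<Pi>\<^sub>M c\<in>C. lborel. finite {z \<in> ?W \<rightarrow>\<^sub>E (UNIV :: complex set).
      \<forall>c\<in>C. poly_eval (F c) z = of_real (y c)}"
    using fin by (intro generic_fibre_finite) auto
  then show ?thesis
  proof eventually_elim
    case (elim y)
    \<comment> \<open>The point of the fibre that belongs to a solution \<open>x\<close>, with the
      free coefficients supplied by \<open>y\<close>. Its \<open>Inr\<close> coordinates determine
      \<open>x\<close>.\<close>
    let ?z = "\<lambda>x. restrict (case_sum (\<lambda>c. complex_of_real (y c)) x) ?W"
    let ?S = "{x \<in> X \<rightarrow>\<^sub>E UNIV. \<forall>v\<in>X. G v (case_sum (\<lambda>c. of_real (y c)) x) = of_real (y (\<sigma> v))}"
    have "?z x \<in> {z \<in> ?W \<rightarrow>\<^sub>E UNIV. \<forall>c\<in>C. poly_eval (F c) z = of_real (y c)}" if x: "x \<in> ?S" for x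
    proof -
      have "poly_eval (F c) (?z x) = of_real (y c)" if c: "c \<in> C" for c
      proof (cases "c \<in> \<sigma> ` X")
        case True
        then obtain v where v: "v \<in> X" "c = \<sigma> v" by auto
        have "poly_eval (F c) (?z x) = G v (?z x)"
          using v inj by (simp add: F_def p(2))
        also have "\<dots> = G v (case_sum (\<lambda>c. of_real (y c)) x)"
          by (rule poly_on_cong[OF G]) (use v in auto)
        finally show ?thesis using x v by simp
      next
        case False
        with c have "Inl c \<in> ?W" by auto
        with False show ?thesis
          by (simp add: F_def poly_eval_single monom_eval_def)
      qed
      then show ?thesis by auto
    qed
    then have "finite (?z ` ?S)"
      by (intro finite_subset[OF _ elim]) auto
    moreover have "inj_on ?z ?S"
    proof (rule inj_onI)
      fix x x' assume x: "x \<in> ?S" "x' \<in> ?S" and eq: "?z x = ?z x'"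
      have "x v = x' v" if "v \<in> X" for v
      proof -
        have "Inr v \<in> ?W" using that by auto
        then show ?thesis using fun_cong[OF eq, of "Inr v"] by simp
      qed
      then show "x = x'"
        using x by (auto intro: PiE_ext)
    qed
    ultimately show ?case
      by (rule finite_imageD)
  qed
qed

lemma generic_polysI:
  assumes "AE y in \<Pi>\<^sub>M c\<in>obj_coeffs N n a <+> con_coeffs N n m d. lborel.
    P (\<lambda>i. poly_of_coeffs (obj_monoms N n (a i)) (\<lambda>\<alpha>. y (Inl (i, \<alpha>))))
      (\<lambda>i j. poly_of_coeffs (con_monoms n i (d i j)) (\<lambda>\<alpha>. y (Inr ((i, j), \<alpha>))))"
  shows "generic_polys N n m a d P"
proof -
  note eq = PiM_Plus_eq_distr[OF sigma_finite_lborel finite_obj_coeffs[of N n a] finite_con_coeffs[of N n m d]]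
  from AE_distrD[OF measurable_case_sum_PiM[where M = lborel and A = "obj_coeffs N n a" and B = "con_coeffs N n m d"],
     folded eq, OF assms]
  show ?thesis
    by (simp add: generic_polys_def case_prod_beta')
qed

section \<open>KKT systems\<close>

lemma poly_eval_poly_of_coeffs:
  "poly_eval (poly_of_coeffs A c) x = (\<Sum>\<alpha>\<in>A. of_real (c \<alpha>) * monom_eval \<alpha> x)"
  by (simp add: poly_of_coeffs_def poly_eval_sum poly_eval_single)

text \<open>Summing over the prescribed exponents \<open>A\<close> instead of the support gives a
  fixed expression in the coefficients, and only monomials containing \<open>v\<close> contribute to
  it.\<close>

lemma poly_eval_pdiff_poly_of_coeffs:
  assumes "finite A"
  shows "poly_eval (pdiff v (poly_of_coeffs A c)) x =
    (\<Sum>\<alpha>\<in>{\<alpha> \<in> A. Poly_Mapping.lookup \<alpha> v \<noteq> 0}. of_real (c \<alpha>) *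
       (of_nat (Poly_Mapping.lookup \<alpha> v) * monom_eval (\<alpha> - Poly_Mapping.single v 1) x))"
proof -
  let ?p = "poly_of_coeffs A c"
  have lookup: "Poly_Mapping.lookup ?p \<alpha> = (if \<alpha> \<in> A then c \<alpha> else 0)" for \<alpha>
    using assms by (simp add: poly_of_coeffs_def lookup_sum lookup_single when_def)
  then have "Poly_Mapping.keys ?p \<subseteq> A"
    by (auto simp: in_keys_iff split: if_splits)
  then have "pdiff v ?p = (\<Sum>\<alpha>\<in>A. Poly_Mapping.single (\<alpha> - Poly_Mapping.single v 1)
      (Poly_Mapping.lookup ?p \<alpha> * real (Poly_Mapping.lookup \<alpha> v)))"
    unfolding pdiff_def using assms
    by (intro sum.mono_neutral_left) (auto simp: in_keys_iff)
  then have "poly_eval (pdiff v ?p) x = (\<Sum>\<alpha>\<in>A. of_real (c \<alpha>) *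
       (of_nat (Poly_Mapping.lookup \<alpha> v) * monom_eval (\<alpha> - Poly_Mapping.single v 1) x))"
    by (simp add: poly_eval_sum poly_eval_single lookup mult.assoc)
  also have "\<dots> = (\<Sum>\<alpha>\<in>{\<alpha> \<in> A. Poly_Mapping.lookup \<alpha> v \<noteq> 0}. of_real (c \<alpha>) *
       (of_nat (Poly_Mapping.lookup \<alpha> v) * monom_eval (\<alpha> - Poly_Mapping.single v 1) x))"
    using assms by (intro sum.mono_neutral_right) auto
  finally show ?thesis .
qed

lemma keys_minus_single_subset:
  "Poly_Mapping.keys (\<alpha> - Poly_Mapping.single v (k :: nat)) \<subseteq> Poly_Mapping.keys \<alpha>"
  by (auto simp: in_keys_iff lookup_minus)

section \<open>From real to complex points\<close>

lemma monom_eval_restrict_of_real: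
  assumes "Poly_Mapping.keys \<alpha> \<subseteq> V"
  shows "monom_eval \<alpha> (\<lambda>v\<in>V. of_real (x v)) = of_real (monom_eval \<alpha> x)"
proof -
  have "monom_eval \<alpha> (\<lambda>v\<in>V. of_real (x v)) = monom_eval \<alpha> (\<lambda>v. of_real (x v))"
    using assms by (intro monom_eval_cong) auto
  then show ?thesis by (simp add: monom_eval_def)
qed

lemma poly_eval_poly_of_coeffs_of_real:
  assumes "\<And>\<alpha>. \<alpha> \<in> A \<Longrightarrow> Poly_Mapping.keys \<alpha> \<subseteq> V"
  shows "poly_eval (poly_of_coeffs A c) (\<lambda>v\<in>V. of_real (x v)) = of_real (poly_eval (poly_of_coeffs A c) x)"
  using assms by (simp add: poly_eval_poly_of_coeffs monom_eval_restrict_of_real)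

lemma poly_eval_pdiff_poly_of_coeffs_of_real:
  assumes "finite A" "\<And>\<alpha>. \<alpha> \<in> A \<Longrightarrow> Poly_Mapping.keys \<alpha> \<subseteq> V"
  shows "poly_eval (pdiff v (poly_of_coeffs A c)) (\<lambda>v\<in>V. of_real (x v))
    = of_real (poly_eval (pdiff v (poly_of_coeffs A c)) x)"
proof -
  have "Poly_Mapping.keys (\<alpha> - Poly_Mapping.single v 1) \<subseteq> V" if "\<alpha> \<in> A" for \<alpha>
    using assms(2)[OF that] keys_minus_single_subset[of \<alpha> v 1] by auto
  with assms(1) show ?thesis
    by (simp add: poly_eval_pdiff_poly_of_coeffs monom_eval_restrict_of_real)
qed

text \<open>An arbitrary set \<open>A\<close> covers the full equality system and every choice of
  active constraints at once. Multipliers live on \<open>A\<close> only, since free values elsewhere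
  would destroy finiteness.\<close>

definition active_kkt_solutions ::
  "nat \<Rightarrow> (nat \<Rightarrow> nat) \<Rightarrow> (nat \<times> nat) set \<Rightarrow> (nat \<Rightarrow> var rpoly) \<Rightarrow> (nat \<Rightarrow> nat \<Rightarrow> var rpoly)
    \<Rightarrow> ((var \<Rightarrow> complex) \<times> (nat \<times> nat \<Rightarrow> complex)) set" where
  "active_kkt_solutions N n A f g =
     {(x, \<mu>). x \<in> vars N n \<rightarrow>\<^sub>E UNIV \<and> \<mu> \<in> A \<rightarrow>\<^sub>E UNIV \<and>
        (\<forall>i<N. \<forall>v\<in>block n i.
           (\<Sum>j\<in>A `` {i}. \<mu> (i, j) * poly_eval (pdiff v (g i j)) x) = poly_eval (pdiff v (f i)) x) \<and>
        (\<forall>(i, j)\<in>A. poly_eval (g i j) x = 0)}"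

lemma kkt_system_solutions_eq_active:
  "kkt_system_solutions N n m f g = active_kkt_solutions N n (SIGMA i:{..<N}. {..<m i}) f g"
proof -
  have "(SIGMA i:{..<N}. {..<m i}) `` {i} = {..<m i}" if "i < N" for i
    using that by auto
  then show ?thesis
    unfolding kkt_system_solutions_def active_kkt_solutions_def by auto
qed

lemma obj_monoms_keys: "\<alpha> \<in> obj_monoms N n b \<Longrightarrow> Poly_Mapping.keys \<alpha> \<subseteq> vars N n"
  by (simp add: obj_monoms_def)

lemma con_monoms_keys: "i < N \<Longrightarrow> \<alpha> \<in> con_monoms n i D \<Longrightarrow> Poly_Mapping.keys \<alpha> \<subseteq> vars N n"
  by (auto simp: con_monoms_def block_def vars_def)

text \<open>Complementary slackness kills the multipliers of inactive constraints, so a KKT point,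
  regarded as complex, solves the system of its active constraints; real parts recover it.\<close>

lemma kkt_points_subset_active:
  fixes f :: "nat \<Rightarrow> var rpoly" and g :: "nat \<Rightarrow> nat \<Rightarrow> var rpoly"
  assumes EI: "\<And>i. i < N \<Longrightarrow> E i \<union> I i = {..<m i}"
    and f: "f = (\<lambda>i. poly_of_coeffs (obj_monoms N n (a i)) (c i))"
    and g: "g = (\<lambda>i j. poly_of_coeffs (con_monoms n i (d i j)) (c' i j))"
  shows "kkt_points N n E I f g
    \<subseteq> (\<Union>A\<in>Pow (SIGMA i:{..<N}. {..<m i}).
          (\<lambda>(x, \<mu>). \<lambda>v\<in>vars N n. Re (x v)) ` active_kkt_solutions N n A f g)"
proof
  fix x assume x: "x \<in> kkt_points N n E I f g"
  define x' where "x' = (\<lambda>v\<in>vars N n. complex_of_real (x v))"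
  define A where "A = {(i, j). i < N \<and> j < m i \<and> poly_eval (g i j) x = 0}"
  obtain \<mu> where \<mu>0: "\<forall>i<N. (\<forall>v\<in>block n i.
        (\<Sum>j\<in>E i \<union> I i. \<mu> (i, j) * poly_eval (pdiff v (g i j)) x) = poly_eval (pdiff v (f i)) x) \<and>
        (\<forall>j\<in>I i. \<mu> (i, j) \<ge> 0 \<and> \<mu> (i, j) * poly_eval (g i j) x = 0)"
    using x unfolding kkt_points_def by blast
  have \<mu>: "\<And>i v. i < N \<Longrightarrow> v \<in> block n i \<Longrightarrow>
        (\<Sum>j<m i. \<mu> (i, j) * poly_eval (pdiff v (g i j)) x) = poly_eval (pdiff v (f i)) x"
      "\<And>i j. i < N \<Longrightarrow> j \<in> I i \<Longrightarrow> \<mu> (i, j) * poly_eval (g i j) x = 0"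
    using \<mu>0 by (simp_all add: EI[symmetric])
  define \<mu>' where "\<mu>' = (\<lambda>k\<in>A. complex_of_real (\<mu> k))"
  have x0: "x \<in> vars N n \<rightarrow>\<^sub>E UNIV"
      "\<And>i j. i < N \<Longrightarrow> j \<in> E i \<Longrightarrow> poly_eval (g i j) x = 0"
    using x by (auto simp: kkt_points_def)
  have pf: "poly_eval (pdiff v (f i)) x' = of_real (poly_eval (pdiff v (f i)) x)" for v i
    unfolding f x'_def
    by (rule poly_eval_pdiff_poly_of_coeffs_of_real) (auto dest: obj_monoms_keys)
  have pg: "poly_eval (pdiff v (g i j)) x' = of_real (poly_eval (pdiff v (g i j)) x)"
    if "i < N" for v i j
    unfolding g x'_def
    by (rule poly_eval_pdiff_poly_of_coeffs_of_real) (auto dest: con_monoms_keys[OF that])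
  have pg0: "poly_eval (g i j) x' = of_real (poly_eval (g i j) x)" if "i < N" for i j
    unfolding g x'_def
    by (rule poly_eval_poly_of_coeffs_of_real) (auto dest: con_monoms_keys[OF that])
  have "(\<Sum>j\<in>A `` {i}. \<mu>' (i, j) * poly_eval (pdiff v (g i j)) x') = poly_eval (pdiff v (f i)) x'"
    if iv: "i < N" "v \<in> block n i" for i v
  proof -
    have "(\<Sum>j\<in>A `` {i}. \<mu>' (i, j) * poly_eval (pdiff v (g i j)) x')
        = of_real (\<Sum>j\<in>A `` {i}. \<mu> (i, j) * poly_eval (pdiff v (g i j)) x)"
      by (simp add: \<mu>'_def pg iv)
    also have "(\<Sum>j\<in>A `` {i}. \<mu> (i, j) * poly_eval (pdiff v (g i j)) x)
        = (\<Sum>j<m i. \<mu> (i, j) * poly_eval (pdiff v (g i j)) x)"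
    proof (rule sum.mono_neutral_left)
      show "\<forall>j\<in>{..<m i} - A `` {i}. \<mu> (i, j) * poly_eval (pdiff v (g i j)) x = 0"
      proof
        fix j assume j: "j \<in> {..<m i} - A `` {i}"
        \<comment> \<open>At a feasible point an inactive constraint can only be an inequality, so
          its multiplier vanishes.\<close>
        then have "poly_eval (g i j) x \<noteq> 0" "j \<in> E i \<or> j \<in> I i"
          using iv EI[of i] by (auto simp: A_def)
        then have "\<mu> (i, j) = 0"
          using \<mu>(2)[of i j] x0(2)[of i j] iv by auto
        then show "\<mu> (i, j) * poly_eval (pdiff v (g i j)) x = 0" by simp
      qed
    qed (auto simp: A_def)
    finally show ?thesis
      using \<mu>(1)[OF iv] by (simp add: pf)
  qed
  then have "(x', \<mu>') \<in> active_kkt_solutions N n A f g"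
    unfolding active_kkt_solutions_def
    by (auto simp: x'_def \<mu>'_def A_def pg0[unfolded x'_def])
  moreover have "x = (\<lambda>v\<in>vars N n. Re (x' v))"
    using x0(1) by (auto simp: x'_def fun_eq_iff restrict_def PiE_def extensional_def)
  moreover have "A \<in> Pow (SIGMA i:{..<N}. {..<m i})"
    by (auto simp: A_def)
  ultimately show "x \<in> (\<Union>A\<in>Pow (SIGMA i:{..<N}. {..<m i}).
          (\<lambda>(x, \<mu>). \<lambda>v\<in>vars N n. Re (x v)) ` active_kkt_solutions N n A f g)"
    by (intro UN_I[of A] image_eqI[of _ _ "(x', \<mu>')"]) (simp_all only: prod.case)
qed

section \<open>The system of a fixed set of active constraints\<close>

lemma zero_in_con_monoms: "0 \<in> con_monoms n i D"
  by (simp add: con_monoms_def degree_in_def)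

text \<open>Provides the coefficient for which stationarity is solved: \<open>v\<close> lies in one
  block only, so a positive degree bound for that block suffices.\<close>

lemma single_in_obj_monoms:
  assumes "v \<in> block n i" "i < N" "b i > 0"
  shows "Poly_Mapping.single v 1 \<in> obj_monoms N n b"
proof -
  have "degree_in (block n j) (Poly_Mapping.single v 1) \<le> b j" for j
  proof (cases "j = i")
    case True
    then show ?thesis
      using assms by (simp add: degree_in_def lookup_single when_def)
  next
    case False
    then have "v \<notin> block n j" using assms by (auto simp: block_def)
    then show ?thesis
      by (simp add: degree_in_def lookup_single when_def)
  qed
  then show ?thesis
    using assms by (auto simp: obj_monoms_def block_def vars_def)
qed

lemma single_Suc_0_eq_iff:
  "Poly_Mapping.single v (Suc 0) = Poly_Mapping.single w (Suc 0) \<longleftrightarrow> v = w"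
  by (metis lookup_single_eq lookup_single_not_eq nat.distinct(1))

text \<open>A coordinate \<open>v\<close> is matched with stationarity in \<open>v\<close>, a
  multiplier with its constraint. The linear monomial \<open>v\<close> has derivative 1, so every
  equation contains its chosen coefficient linearly with factor 1 and can be solved for it.\<close>

lemma active_kkt_solutions_generic_finite:
  assumes a: "\<And>i. i < N \<Longrightarrow> a i i > 0"
    and A: "A \<subseteq> (SIGMA i:{..<N}. {..<m i})"
  shows "AE y in \<Pi>\<^sub>M c\<in>obj_coeffs N n a <+> con_coeffs N n m d. lborel.
    finite (active_kkt_solutions N n A
      (\<lambda>i. poly_of_coeffs (obj_monoms N n (a i)) (\<lambda>\<alpha>. y (Inl (i, \<alpha>))))
      (\<lambda>i j. poly_of_coeffs (con_monoms n i (d i j)) (\<lambda>\<alpha>. y (Inr ((i, j), \<alpha>)))))"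
proof -
  define C where "C = obj_coeffs N n a <+> con_coeffs N n m d"
  define X where "X = vars N n <+> A"
  define \<sigma> :: "var + nat \<times> nat \<Rightarrow> (nat \<times> var monom) + ((nat \<times> nat) \<times> var monom)"
    where "\<sigma> = case_sum (\<lambda>v. Inl (fst v, Poly_Mapping.single v 1)) (\<lambda>k. Inr (k, 0))"
  define W where "W = (C - \<sigma> ` X) <+> X"
  \<comment> \<open>Monomials of degree 0 in \<open>v\<close> must be left out here: their coefficients may be ones that are
    solved for, on which \<open>G\<close> must not depend.\<close>
  define O' where "O' = (\<lambda>v. {\<alpha> \<in> obj_monoms N n (a (fst v)). Poly_Mapping.lookup \<alpha> v \<noteq> 0})"
  define M where "M = (\<lambda>v j. {\<alpha> \<in> con_monoms n (fst v) (d (fst v) j). Poly_Mapping.lookup \<alpha> v \<noteq> 0})"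
  define mon :: "var monom \<Rightarrow>
      (((nat \<times> var monom) + ((nat \<times> nat) \<times> var monom)) + (var + nat \<times> nat) \<Rightarrow> complex) \<Rightarrow> complex"
    where "mon = (\<lambda>\<alpha> z. monom_eval \<alpha> (\<lambda>v. z (Inr (Inl v))))"
  define dmon where "dmon = (\<lambda>v \<alpha> z. of_nat (Poly_Mapping.lookup \<alpha> v) * mon (\<alpha> - Poly_Mapping.single v 1) z)"
  \<comment> \<open>What an equation says about its chosen coefficient once all other terms are
    moved to one side.\<close>
  define G where "G = case_sum
    (\<lambda>v z. (\<Sum>j\<in>A `` {fst v}. z (Inr (Inr (fst v, j))) *
             (\<Sum>\<alpha>\<in>M v j. z (Inl (Inr ((fst v, j), \<alpha>))) * dmon v \<alpha> z))
         - (\<Sum>\<alpha>\<in>O' v - {Poly_Mapping.single v 1}. z (Inl (Inl (fst v, \<alpha>))) * dmon v \<alpha> z))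
    (\<lambda>k z. 0 - (\<Sum>\<alpha>\<in>con_monoms n (fst k) (d (fst k) (snd k)) - {0}. z (Inl (Inr (k, \<alpha>))) * mon \<alpha> z))"
  have fin: "finite C" "finite X"
    unfolding C_def X_def using A by (auto intro: finite_subset)
  have inj: "inj_on \<sigma> X"
    by (auto simp: inj_on_def \<sigma>_def single_Suc_0_eq_iff split: sum.splits)
  have sub: "\<sigma> ` X \<subseteq> C"
  proof -
    have "(fst v, Poly_Mapping.single v 1) \<in> obj_coeffs N n a" if "v \<in> vars N n" for v
      using that a single_in_obj_monoms[of v n "fst v" N "a (fst v)"]
      by (auto simp: obj_coeffs_def vars_def block_def)
    moreover have "(k, 0) \<in> con_coeffs N n m d" if "k \<in> A" for k
      using that A zero_in_con_monoms by (force simp: con_coeffs_def)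
    ultimately show ?thesis
      by (auto simp: \<sigma>_def X_def C_def)
  qed
  have mon: "poly_on W (mon \<alpha>)" if "Poly_Mapping.keys \<alpha> \<subseteq> vars N n" for \<alpha>
    unfolding mon_def by (rule poly_on_monom_eval) (use that in \<open>auto simp: W_def X_def\<close>)
  have dmon: "poly_on W (dmon v \<alpha>)" if "Poly_Mapping.keys \<alpha> \<subseteq> vars N n" for v \<alpha>
    unfolding dmon_def using that keys_minus_single_subset[of \<alpha> v 1]
    by (intro poly_on_mult poly_on_of_nat mon) auto
  have G: "poly_on W (G k)" if "k \<in> X" for k
  proof (cases k)
    case (Inl v)
    with that have v: "v \<in> vars N n" "fst v < N" by (auto simp: X_def vars_def)
    have "Inl (Inl (fst v, \<alpha>)) \<in> W" if "\<alpha> \<in> O' v - {Poly_Mapping.single v 1}" for \<alpha>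
    proof -
      \<comment> \<open>Linear monomials of other coordinates do not contain \<open>v\<close>, so no
        objective coefficient that is solved for remains in this equation.\<close>
      have "\<alpha> \<noteq> Poly_Mapping.single w 1" for w
        using that by (cases "w = v") (auto simp: O'_def lookup_single_not_eq)
      with that v show ?thesis
        by (auto simp: W_def C_def X_def \<sigma>_def obj_coeffs_def O'_def)
    qed
    moreover have "Inl (Inr ((fst v, j), \<alpha>)) \<in> W" if "j \<in> A `` {fst v}" "\<alpha> \<in> M v j" for j \<alpha>
    proof -
      \<comment> \<open>The constraint coefficients that are solved for are constant terms, which
        differentiation removes.\<close>
      have "\<alpha> \<noteq> 0" using that by (auto simp: M_def)
      with that A show ?thesis
        by (auto simp: W_def C_def X_def \<sigma>_def con_coeffs_def M_def)
    qed
    moreover have "Inr (Inr (fst v, j)) \<in> W" if "j \<in> A `` {fst v}" for j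
      using that by (auto simp: W_def X_def)
    ultimately show ?thesis
      using v unfolding G_def Inl sum.case
      by (intro poly_on_diff poly_on_sum poly_on_mult poly_on_var dmon)
         (auto simp: M_def O'_def dest: obj_monoms_keys con_monoms_keys)
  next
    case (Inr ij)
    with that A obtain i j where ij: "ij = (i, j)" "i < N" "(i, j) \<in> A" "j < m i"
      by (cases ij) (auto simp: X_def)
    have "Inl (Inr (ij, \<alpha>)) \<in> W" if "\<alpha> \<in> con_monoms n i (d i j) - {0}" for \<alpha>
      using that ij by (auto simp: W_def C_def X_def \<sigma>_def con_coeffs_def)
    then show ?thesis
      using ij poly_on_of_nat[of W 0] unfolding G_def Inr sum.case
      by (intro poly_on_diff poly_on_sum poly_on_mult poly_on_var mon)
         (auto dest: con_monoms_keys[OF ij(2)])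
  qed
  have "AE y in \<Pi>\<^sub>M c\<in>C. lborel. finite {x \<in> X \<rightarrow>\<^sub>E UNIV.
           \<forall>k\<in>X. G k (case_sum (\<lambda>c. of_real (y c)) x) = of_real (y (\<sigma> k))}"
    by (rule generic_solutions_finite[OF fin inj sub G[unfolded W_def]])
  then show ?thesis
    unfolding C_def[symmetric]
  proof eventually_elim
    case (elim y)
    let ?f = "\<lambda>i. poly_of_coeffs (obj_monoms N n (a i)) (\<lambda>\<alpha>. y (Inl (i, \<alpha>)))"
    let ?g = "\<lambda>i j. poly_of_coeffs (con_monoms n i (d i j)) (\<lambda>\<alpha>. y (Inr ((i, j), \<alpha>)))"
    let ?S = "{x \<in> X \<rightarrow>\<^sub>E UNIV. \<forall>k\<in>X. G k (case_sum (\<lambda>c. of_real (y c)) x) = of_real (y (\<sigma> k))}"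
    \<comment> \<open>A solution pair is encoded as one function on the disjoint union
      \<open>X\<close>.\<close>
    have "active_kkt_solutions N n A ?f ?g \<subseteq> (\<lambda>h. (h \<circ> Inl, h \<circ> Inr)) ` ?S"
    proof safe
      fix x \<mu> assume sol: "(x, \<mu>) \<in> active_kkt_solutions N n A ?f ?g"
      let ?z = "case_sum (\<lambda>c. of_real (y c)) (case_sum x \<mu>)"
      have "case_sum x \<mu> \<in> X \<rightarrow>\<^sub>E UNIV"
        using sol by (auto simp: active_kkt_solutions_def X_def PiE_def extensional_def split: sum.splits)
      moreover have "G k ?z = of_real (y (\<sigma> k))" if "k \<in> X" for k
      proof (cases k)
        case (Inl v)
        with that have v: "v \<in> vars N n" "fst v < N" "v \<in> block n (fst v)"
          by (auto simp: X_def vars_def block_def)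
        have s: "Poly_Mapping.single v 1 \<in> O' v"
          using single_in_obj_monoms[of v n "fst v" N "a (fst v)"] v a by (simp add: O'_def)
        have "(\<Sum>j\<in>A `` {fst v}. \<mu> (fst v, j) * poly_eval (pdiff v (?g (fst v) j)) x)
            = poly_eval (pdiff v (?f (fst v))) x"
          using sol v by (auto simp: active_kkt_solutions_def)
        also have "\<dots> = (\<Sum>\<alpha>\<in>O' v. ?z (Inl (Inl (fst v, \<alpha>))) * dmon v \<alpha> ?z)"
          by (simp add: poly_eval_pdiff_poly_of_coeffs O'_def dmon_def mon_def)
        also have "\<dots> = of_real (y (\<sigma> k))
            + (\<Sum>\<alpha>\<in>O' v - {Poly_Mapping.single v 1}. ?z (Inl (Inl (fst v, \<alpha>))) * dmon v \<alpha> ?z)"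
          by (subst sum.remove[OF _ s])
             (simp_all add: O'_def Inl \<sigma>_def dmon_def mon_def monom_eval_def)
        finally show ?thesis
          by (simp add: G_def Inl poly_eval_pdiff_poly_of_coeffs M_def dmon_def mon_def)
      next
        case (Inr ij)
        with that A obtain i j where ij: "ij = (i, j)" "i < N" "(i, j) \<in> A" "j < m i"
          by (cases ij) (auto simp: X_def)
        have "0 = poly_eval (?g i j) x"
          using sol ij by (auto simp: active_kkt_solutions_def)
        also have "\<dots> = of_real (y (\<sigma> k))
            + (\<Sum>\<alpha>\<in>con_monoms n i (d i j) - {0}. of_real (y (Inr ((i, j), \<alpha>))) * monom_eval \<alpha> x)"
          unfolding poly_eval_poly_of_coeffs
          by (subst sum.remove[OF finite_con_monoms zero_in_con_monoms])
             (simp add: Inr ij \<sigma>_def monom_eval_def)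
        finally show ?thesis
          by (simp add: G_def Inr ij mon_def add_eq_0_iff2)
      qed
      ultimately have "case_sum x \<mu> \<in> ?S" by blast
      moreover have "(x, \<mu>) = (case_sum x \<mu> \<circ> Inl, case_sum x \<mu> \<circ> Inr)"
        by (auto simp: fun_eq_iff)
      ultimately show "(x, \<mu>) \<in> (\<lambda>h. (h \<circ> Inl, h \<circ> Inr)) ` ?S"
        by (intro image_eqI[of _ _ "case_sum x \<mu>"])
    qed
    then show ?case
      using elim by (rule finite_subset[OF _ finite_imageI])
  qed
qed

theorem theoremA1:
  fixes N :: nat
    and n m :: "nat \<Rightarrow> nat"
    and d a :: "nat \<Rightarrow> nat \<Rightarrow> nat"
    and E I :: "nat \<Rightarrow> nat set"
  assumes d_pos: "\<And>i j. i < N \<Longrightarrow> j < m i \<Longrightarrow> d i j > 0"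
    and a_pos: "\<And>i j. i < N \<Longrightarrow> j < N \<Longrightarrow> a i j > 0"
    and EI_union: "\<And>i. i < N \<Longrightarrow> E i \<union> I i = {..<m i}"
    and EI_disjoint: "\<And>i. i < N \<Longrightarrow> E i \<inter> I i = {}"
  shows "generic_polys N n m a d (\<lambda>f g.
           finite (kkt_system_solutions N n m f g) \<and> finite (kkt_points N n E I f g))"
proof (rule generic_polysI)
  let ?f = "\<lambda>y i. poly_of_coeffs (obj_monoms N n (a i)) (\<lambda>\<alpha>. y (Inl (i, \<alpha>)))"
  let ?g = "\<lambda>y i j. poly_of_coeffs (con_monoms n i (d i j)) (\<lambda>\<alpha>. y (Inr ((i, j), \<alpha>)))"
  let ?S = "SIGMA i:{..<N}. {..<m i}"
  \<comment> \<open>There are finitely many sets \<open>A\<close>, so the exceptional null sets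
    unite to a null set.\<close>
  have "AE y in \<Pi>\<^sub>M c\<in>obj_coeffs N n a <+> con_coeffs N n m d. lborel.
      \<forall>A\<in>Pow ?S. finite (active_kkt_solutions N n A (?f y) (?g y))"
    using a_pos by (intro AE_finite_allI active_kkt_solutions_generic_finite) auto
  then show "AE y in \<Pi>\<^sub>M c\<in>obj_coeffs N n a <+> con_coeffs N n m d. lborel.
      finite (kkt_system_solutions N n m (?f y) (?g y)) \<and> finite (kkt_points N n E I (?f y) (?g y))"
  proof eventually_elim
    case (elim y)
    have "finite (kkt_points N n E I (?f y) (?g y))"
      by (rule finite_subset[OF kkt_points_subset_active[OF EI_union refl refl]])
         (use elim in auto)
    \<comment> \<open>The equality system is the case \<open>A = ?S\<close>.\<close>
    then show ?case
      using elim by (auto simp: kkt_system_solutions_eq_active)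
  qed
qed

end
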